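(* Let $X$ be a Banach space and let $\{\varphi_t : X\to X \mid t\ge 0\}$ be a bounded semigroup of linear operators such that for each $v\in X$ the function $t\mapsto \varphi_t(v)$ is continuous for $t>0$. Let $X_0=\{x\in X\mid \varphi_t(x)\to 0 \text{ as } t\to\infty\}$ and suppose that $\operatorname{codim} X_0=n<\infty$. Let $Y\subset X$ be an $n$-dimensional subspace such that $X_0\oplus Y=X$, and write $Y_t=\varphi_t(Y)$. Suppose that the orbit $E_0=\{\varphi_t(e)\mid t\ge 0\}$ of every vector $e\in Y$ is weakly precompact. Then $Y$ is stabilizable; i.e., there is a $\varphi_t$-invariant subspace $Y_\infty\subset X$ such that $X=X_0\oplus Y_\infty$ and $\angle(Y_T,Y_\infty)\to 0$ as $T\to\infty$. In particular, if $X$ is reflexive then $Y$ is stabilizable.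
   Context: A semigroup means $\varphi_t\circ\varphi_q=\varphi_{t+q}$ for all $t,q\ge 0$; it is bounded if there is a constant $C<\infty$ with $\|\varphi_t\|\le C$ for all $t\ge 0$. A set is weakly precompact if its closure in the weak topology of $X$ is weakly compact. A subspace $Z$ is $\varphi_t$-invariant if $\varphi_t(Z)\subset Z$ for all $t\geq 0$. For subspaces $A,B\subset X$ the angle is $$\angle(A,B)=\min\Bigl\{\sup_{a\in A,\,|a|=1}\rho(a,B),\ \sup_{b\in B,\,|b|=1}\rho(b,A)\Bigr\},$$ where $\rho(v,A)$ denotes the distance from the vector $v$ to the subspace $A$. *)

theory Defs
  imports "HOL-Analysis.Analysis"
begin

text \<open>
  Real and complex Banach spaces are treated at once. By the Gelfand--Mazur theorem the only
  fields in the sort \<open>{real_normed_field, euclidean_space}\<close> are, up to isomorphism, the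
  reals and the complex numbers. Completeness comes from the class \<open>banach\<close> of the vectors.
\<close>

locale normed_space_over = vector_space sc
  for sc :: "'k::{real_normed_field,euclidean_space} \<Rightarrow> 'a::real_normed_vector \<Rightarrow> 'a" +
  assumes norm_scale: "norm (sc c x) = norm c * norm x"
    and scale_of_real: "sc (of_real r) x = r *\<^sub>R x"

lemma normed_space_over_real:
  "normed_space_over (scaleR :: real \<Rightarrow> 'a::real_normed_vector \<Rightarrow> 'a)"
  by unfold_locales (simp_all add: scaleR_add_left scaleR_add_right)

lemma normed_space_over_complex: "normed_space_over ((*) :: complex \<Rightarrow> complex \<Rightarrow> complex)"
  by unfold_locales (simp_all add: ring_distribs norm_mult scaleR_conv_of_real)

text \<open>The library's \<open>dim\<close> is \<open>0\<close> on infinite-dimensional spaces, hence the explicit finite bases.\<close>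

definition has_dim :: "('k::field \<Rightarrow> 'a::ab_group_add \<Rightarrow> 'a) \<Rightarrow> 'a set \<Rightarrow> nat \<Rightarrow> bool" where
  "has_dim sc S n \<longleftrightarrow> module.subspace sc S \<and>
     (\<exists>B. finite B \<and> card B = n \<and> \<not> module.dependent sc B \<and> module.span sc B = S)"

text \<open>The cosets of the elements of \<open>B\<close> form a basis, with \<open>n\<close> elements, of the quotient by \<open>S\<close>.\<close>

definition has_codim :: "('k::field \<Rightarrow> 'a::ab_group_add \<Rightarrow> 'a) \<Rightarrow> 'a set \<Rightarrow> nat \<Rightarrow> bool" where
  "has_codim sc S n \<longleftrightarrow> module.subspace sc S \<and>
     (\<exists>B. finite B \<and> card B = n \<and>
        (\<forall>u. (\<Sum>b\<in>B. sc (u b) b) \<in> S \<longrightarrow> (\<forall>b\<in>B. u b = 0)) \<and>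
        module.span sc (S \<union> B) = UNIV)"

definition is_direct_sum :: "('k::field \<Rightarrow> 'a::ab_group_add \<Rightarrow> 'a) \<Rightarrow> 'a set \<Rightarrow> 'a set \<Rightarrow> bool" where
  "is_direct_sum sc A B \<longleftrightarrow> module.subspace sc A \<and> module.subspace sc B \<and>
     A \<inter> B = {0} \<and> (\<forall>x. \<exists>a\<in>A. \<exists>b\<in>B. x = a + b)"

definition dual :: "('k::{real_normed_field,euclidean_space} \<Rightarrow> 'a::real_normed_vector \<Rightarrow> 'a)
    \<Rightarrow> ('a \<Rightarrow> 'k) set" where
  "dual sc = {f. Vector_Spaces.linear sc (*) f \<and> bounded_linear f}"

definition weak_topology :: "('k::{real_normed_field,euclidean_space} \<Rightarrow> 'a::real_normed_vector \<Rightarrow> 'a)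
    \<Rightarrow> 'a topology" where
  "weak_topology sc = topology_generated_by {f -` U | f U. f \<in> dual sc \<and> open U}"

definition weakly_precompact :: "('k::{real_normed_field,euclidean_space} \<Rightarrow> 'a::real_normed_vector \<Rightarrow> 'a)
    \<Rightarrow> 'a set \<Rightarrow> bool" where
  "weakly_precompact sc S \<longleftrightarrow>
     compactin (weak_topology sc) (weak_topology sc closure_of S)"

text \<open>Every bounded linear functional on the dual is evaluation at a vector; the values of
  \<open>\<Phi>\<close> outside the dual are irrelevant.\<close>

definition reflexive :: "('k::{real_normed_field,euclidean_space} \<Rightarrow> 'a::real_normed_vector \<Rightarrow> 'a)
    \<Rightarrow> bool" where
  "reflexive sc \<longleftrightarrow>
     (\<forall>\<Phi> :: ('a \<Rightarrow> 'k) \<Rightarrow> 'k.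
        (\<forall>f\<in>dual sc. \<forall>g\<in>dual sc. \<Phi> (\<lambda>x. f x + g x) = \<Phi> f + \<Phi> g) \<and>
        (\<forall>f\<in>dual sc. \<forall>c. \<Phi> (\<lambda>x. c * f x) = c * \<Phi> f) \<and>
        (\<exists>M. \<forall>f\<in>dual sc. norm (\<Phi> f) \<le> M * onorm f)
        \<longrightarrow> (\<exists>x. \<forall>f\<in>dual sc. \<Phi> f = f x))"

text \<open>
  Operators are indexed by all reals, but only the indices \<open>t \<ge> 0\<close> are constrained.
  Neither \<open>\<phi> 0 = id\<close> nor continuity at \<open>0\<close> is part of the definition.
\<close>

definition bounded_semigroup :: "('k::{real_normed_field,euclidean_space} \<Rightarrow> 'a::real_normed_vector \<Rightarrow> 'a)
    \<Rightarrow> (real \<Rightarrow> 'a \<Rightarrow> 'a) \<Rightarrow> bool" where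
  "bounded_semigroup sc \<phi> \<longleftrightarrow>
     (\<forall>t\<ge>0. Vector_Spaces.linear sc sc (\<phi> t)) \<and>
     (\<forall>t\<ge>0. \<forall>q\<ge>0. \<phi> t \<circ> \<phi> q = \<phi> (t + q)) \<and>
     (\<exists>C. \<forall>t\<ge>0. bounded_linear (\<phi> t) \<and> onorm (\<phi> t) \<le> C)"

definition null_space :: "(real \<Rightarrow> 'a::real_normed_vector \<Rightarrow> 'a) \<Rightarrow> 'a set" where
  "null_space \<phi> = {x. ((\<lambda>t. \<phi> t x) \<longlongrightarrow> 0) at_top}"

definition invariant :: "(real \<Rightarrow> 'a \<Rightarrow> 'a) \<Rightarrow> 'a set \<Rightarrow> bool" where
  "invariant \<phi> Z \<longleftrightarrow> (\<forall>t\<ge>0. \<phi> t ` Z \<subseteq> Z)"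

text \<open>Inserting \<open>0\<close> only matters for \<open>A = {0}\<close>, where the supremum of the empty set of
  distances is \<open>0\<close>. All distances in question are at most \<open>1\<close> when \<open>0 \<in> B\<close>.\<close>

definition deviation :: "'a::real_normed_vector set \<Rightarrow> 'a set \<Rightarrow> real" where
  "deviation A B = Sup (insert 0 ((\<lambda>a. infdist a B) ` {a \<in> A. norm a = 1}))"

definition subspace_angle :: "'a::real_normed_vector set \<Rightarrow> 'a set \<Rightarrow> real" where
  "subspace_angle A B = min (deviation A B) (deviation B A)"

definition stabilizable :: "('k::{real_normed_field,euclidean_space} \<Rightarrow> 'a::real_normed_vector \<Rightarrow> 'a)
    \<Rightarrow> (real \<Rightarrow> 'a \<Rightarrow> 'a) \<Rightarrow> 'a set \<Rightarrow> bool" where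
  "stabilizable sc \<phi> Y \<longleftrightarrow>
     (\<exists>Z. module.subspace sc Z \<and> invariant \<phi> Z \<and> is_direct_sum sc (null_space \<phi>) Z \<and>
          ((\<lambda>T. subspace_angle (\<phi> T ` Y) Z) \<longlongrightarrow> 0) at_top)"

end

theory Submission
  imports Defs
begin

text \<open>
  Let \<open>Y\<close> be the given complement of the null space \<open>X\<^sub>0\<close> and choose a basis \<open>B\<close> of \<open>Y\<close>. By weak
  compactness there is a filter \<open>G\<close> finer than \<open>t \<rightarrow> \<infinity>\<close> along which \<open>\<phi> t b\<close> converges weakly for each
  of the finitely many \<open>b \<in> B\<close>. On \<open>X\<^sub>0\<close> the semigroup tends to \<open>0\<close>, so \<open>\<phi> t x\<close> converges weakly along
  \<open>G\<close> for every \<open>x\<close>, and the limits define a linear operator \<open>L\<close>. The invariant subspace is the range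
  of \<open>L\<close>.

  It is invariant because \<open>L\<close> commutes with each \<open>\<phi> s\<close>: both \<open>\<phi> s (L x)\<close> and \<open>L (\<phi> s x)\<close> are the weak
  limit of \<open>\<phi> (s + t) x\<close> (\<open>semigroup_limit_operator\<close>). Weak limits are unique because the dual
  separates points; this is the Hahn--Banach theorem over the reals, transferred to the scalar field
  (\<open>dual_separates_points\<close>).

  It is a complement because \<open>L x \<in> X\<^sub>0\<close> holds only for \<open>x \<in> X\<^sub>0\<close>
  (\<open>limit_operator_in_null_space_iff\<close>). The main tool is the seminorm
  \<open>p x = limsup norm (\<phi> t x)\<close>. It vanishes exactly on \<open>X\<^sub>0\<close>, is invariant under the semigroup, and
  is bounded by a constant times \<open>norm (\<phi> t x)\<close> for each \<open>t\<close>. On the finite-dimensional \<open>Y\<close> it is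
  a norm, so it is equivalent to the size of the coordinates (\<open>coord_bounded_by_asymptotic_norm\<close>).
  Hence the coordinates of the projection onto \<open>Y\<close> along \<open>X\<^sub>0\<close> are continuous functionals. If
  \<open>L x \<in> X\<^sub>0\<close>, then the coordinates of \<open>\<phi> t x\<close> tend to \<open>0\<close> along \<open>G\<close>, and with them
  \<open>p (\<phi> t x) = p x\<close>. So \<open>L\<close> induces an injective map of the \<open>n\<close>-dimensional quotient by \<open>X\<^sub>0\<close>. This map
  is surjective as well, which says that \<open>X\<^sub>0\<close> and the range of \<open>L\<close> span the space.

  For the angle, write \<open>b = (b - z) + z\<close> with \<open>b - z \<in> X\<^sub>0\<close> and \<open>z\<close> in the range of \<open>L\<close>. Then \<open>\<phi> T b\<close>
  approaches \<open>\<phi> T z\<close>, a vector of the range of \<open>L\<close>. The approach is uniform on the unit sphere of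
  \<open>\<phi> T ` Y\<close>, since the coordinates of \<open>y \<in> Y\<close> are bounded by a constant times \<open>norm (\<phi> T y)\<close>
  uniformly in \<open>T\<close> (\<open>coord_bounded_by_orbit\<close>).

  In a reflexive space the orbits, being bounded, have weak limits along finer filters
  (\<open>reflexive_has_weak_limits\<close>), and the same argument applies.
\<close>

section \<open>Hahn--Banach: the dual separates points\<close>
text \<open>
  Linear functionals are obtained as minimal elements among the sublinear ones. This form of the
  Hahn--Banach argument works with total functions only, whereas extending a functional from
  subspace to subspace would need partial ones.
\<close>

definition sublinear :: "('a::real_vector \<Rightarrow> real) \<Rightarrow> bool" where
  "sublinear p \<longleftrightarrow> (\<forall>x y. p (x + y) \<le> p x + p y) \<and> (\<forall>r>0. \<forall>x. p (r *\<^sub>R x) \<le> r * p x)"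

lemma sublinearD:
  assumes "sublinear p"
  shows "p (x + y) \<le> p x + p y" and "r > 0 \<Longrightarrow> p (r *\<^sub>R x) = r * p x"
    and "p 0 = 0" and "- p (- x) \<le> p x"
proof -
  have add: "p (x + y) \<le> p x + p y" for x y
    using assms by (auto simp: sublinear_def)
  have scale: "p (r *\<^sub>R x) \<le> r * p x" if "r > 0" for r x
    using assms that by (auto simp: sublinear_def)
  show "p (x + y) \<le> p x + p y" by (rule add)
  show homog: "p (r *\<^sub>R x) = r * p x" if "r > 0" for r x
    using scale[OF that, of x] scale[of "inverse r" "r *\<^sub>R x"] that by (simp add: field_simps)
  show zero: "p 0 = 0"
    using homog[of 2 0] by simp
  show "- p (- x) \<le> p x"
    using add[of x "- x"] zero by simp
qed

lemma sublinear_norm: "sublinear norm"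
  by (simp add: sublinear_def norm_triangle_ineq)

text \<open>
  The standard way to decrease a sublinear functional: \<open>tilt p y\<close> is again sublinear and lies
  below \<open>p\<close>, and in the direction \<open>- y\<close> it has dropped to at most \<open>- p y\<close>, the value there of
  every linear functional that agrees with \<open>p\<close> at \<open>y\<close>.
\<close>

definition tilt :: "('a::real_vector \<Rightarrow> real) \<Rightarrow> 'a \<Rightarrow> 'a \<Rightarrow> real" where
  "tilt p y x = (INF t\<in>{0<..}. p (x + t *\<^sub>R y) - t * p y)"

lemma tilt_le:
  assumes "sublinear p" and "t > 0"
  shows "tilt p y x \<le> p (x + t *\<^sub>R y) - t * p y"
proof -
  have "bdd_below ((\<lambda>t. p (x + t *\<^sub>R y) - t * p y) ` {0<..})"
  proof (rule bdd_belowI2)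
    fix t :: real assume t: "t \<in> {0<..}"
    have "t * p y = p ((x + t *\<^sub>R y) + - x)"
      using sublinearD(2)[OF assms(1)] t by simp
    also have "\<dots> \<le> p (x + t *\<^sub>R y) + p (- x)"
      by (rule sublinearD(1)[OF assms(1)])
    finally show "- p (- x) \<le> p (x + t *\<^sub>R y) - t * p y" by simp
  qed
  then show ?thesis
    unfolding tilt_def using assms(2) by (intro cINF_lower) auto
qed

lemma le_tilt:
  assumes "\<And>t. t > 0 \<Longrightarrow> m \<le> p (x + t *\<^sub>R y) - t * p y"
  shows "m \<le> tilt p y x"
  unfolding tilt_def using assms by (intro cINF_greatest) auto

lemma tilt_le_self:
  assumes "sublinear p"
  shows "tilt p y x \<le> p x"
  using tilt_le[OF assms, of 1 y x] sublinearD(1)[OF assms, of x y] by simp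

lemma sublinear_tilt:
  assumes p: "sublinear p"
  shows "sublinear (tilt p y)"
  unfolding sublinear_def
proof (intro conjI allI impI)
  fix x z
  have *: "tilt p y (x + z) \<le> (p (x + s *\<^sub>R y) - s * p y) + (p (z + t *\<^sub>R y) - t * p y)"
    if "s > 0" "t > 0" for s t
  proof -
    have "tilt p y (x + z) \<le> p ((x + z) + (s + t) *\<^sub>R y) - (s + t) * p y"
      using that by (intro tilt_le[OF p]) auto
    also have "(x + z) + (s + t) *\<^sub>R y = (x + s *\<^sub>R y) + (z + t *\<^sub>R y)"
      by (simp add: algebra_simps)
    also have "p \<dots> \<le> p (x + s *\<^sub>R y) + p (z + t *\<^sub>R y)"
      by (rule sublinearD(1)[OF p])
    finally show ?thesis by (simp add: algebra_simps)
  qed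
  have "tilt p y (x + z) - (p (x + s *\<^sub>R y) - s * p y) \<le> tilt p y z" if "s > 0" for s
    using *[OF that] by (intro le_tilt) (simp add: algebra_simps)
  then have "tilt p y (x + z) - tilt p y z \<le> tilt p y x"
    by (intro le_tilt) (simp add: algebra_simps)
  then show "tilt p y (x + z) \<le> tilt p y x + tilt p y z" by simp
next
  fix r :: real and x assume r: "r > 0"
  have "tilt p y (r *\<^sub>R x) / r \<le> tilt p y x"
  proof (rule le_tilt)
    fix t :: real assume t: "t > 0"
    have "tilt p y (r *\<^sub>R x) \<le> p (r *\<^sub>R x + (r * t) *\<^sub>R y) - (r * t) * p y"
      using r t by (intro tilt_le[OF p]) simp
    also have "r *\<^sub>R x + (r * t) *\<^sub>R y = r *\<^sub>R (x + t *\<^sub>R y)"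
      by (simp add: algebra_simps)
    also have "p \<dots> = r * p (x + t *\<^sub>R y)"
      by (rule sublinearD(2)[OF p r])
    finally show "tilt p y (r *\<^sub>R x) / r \<le> p (x + t *\<^sub>R y) - t * p y"
      using r by (simp add: field_simps)
  qed
  then show "tilt p y (r *\<^sub>R x) \<le> r * tilt p y x"
    using r by (simp add: field_simps)
qed

lemma tilt_uminus_le:
  assumes "sublinear p"
  shows "tilt p y (- y) \<le> - p y"
  using tilt_le[OF assms, of 1 y "- y"] sublinearD(3)[OF assms] by simp

text \<open>
  Zorn's lemma applies because the pointwise infimum of a chain is finite, being bounded below by
  \<open>- q (- x)\<close> at \<open>x\<close>, and sublinear.
\<close>

lemma ex_minimal_sublinear_le:
  fixes q :: "'a::real_vector \<Rightarrow> real"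
  assumes q: "sublinear q"
  obtains p where "sublinear p" "p \<le> q" "\<And>p'. sublinear p' \<Longrightarrow> p' \<le> p \<Longrightarrow> p' = p"
proof -
  let ?A = "{p. sublinear p \<and> p \<le> q}"
  have "\<exists>p\<in>?A. \<forall>p'\<in>?A. p' \<le> p \<longrightarrow> p' = p"
  proof (rule predicate_Zorn)
    show "partial_order_on ?A (relation_of (\<lambda>p p'. p' \<le> p) ?A)"
      by (rule partial_order_on_relation_ofI) auto
  next
    fix C assume C: "C \<in> Chains (relation_of (\<lambda>p p'. p' \<le> p) ?A)"
    then have CA: "C \<subseteq> ?A" and chain: "\<And>p p'. p \<in> C \<Longrightarrow> p' \<in> C \<Longrightarrow> p' \<le> p \<or> p \<le> p'"
      by (auto simp: Chains_def relation_of_def)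
    show "\<exists>u\<in>?A. \<forall>p\<in>C. u \<le> p"
    proof (cases "C = {}")
      case True
      then show ?thesis using q by auto
    next
      case False
      define u where "u x = (INF p\<in>C. p x)" for x
      have bdd: "bdd_below ((\<lambda>p. p x) ` C)" for x
      proof (rule bdd_belowI2)
        fix p assume "p \<in> C"
        then have p: "sublinear p" "p (- x) \<le> q (- x)"
          using CA by (auto simp: le_fun_def)
        then show "- q (- x) \<le> p x"
          using sublinearD(4)[OF p(1), of x] by linarith
      qed
      have u_le: "u x \<le> p x" if "p \<in> C" for p x
        unfolding u_def using bdd that by (rule cINF_lower)
      have le_u: "m \<le> u x" if "\<And>p. p \<in> C \<Longrightarrow> m \<le> p x" for m x
        unfolding u_def using False that by (intro cINF_greatest)
      have "sublinear u"
        unfolding sublinear_def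
      proof (intro conjI allI impI)
        fix x y
        have *: "u (x + y) \<le> p x + p' y" if pp': "p \<in> C" "p' \<in> C" for p p'
        proof -
          \<comment> \<open>On a chain the smaller of two functionals serves both summands.\<close>
          obtain m where m: "m \<in> C" "m \<le> p" "m \<le> p'"
            using chain[OF pp'] pp' by blast
          have "u (x + y) \<le> m (x + y)" by (rule u_le[OF m(1)])
          also have "\<dots> \<le> m x + m y"
            using m(1) CA by (intro sublinearD(1)) auto
          also have "\<dots> \<le> p x + p' y"
            using m(2,3) by (intro add_mono) (auto simp: le_fun_def)
          finally show ?thesis .
        qed
        have "u (x + y) - p x \<le> u y" if "p \<in> C" for p
          using *[OF that] by (intro le_u) (simp add: algebra_simps)
        then have "u (x + y) - u y \<le> u x"
          by (intro le_u) (simp add: algebra_simps)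
        then show "u (x + y) \<le> u x + u y" by simp
      next
        fix r :: real and x assume r: "r > 0"
        have "u (r *\<^sub>R x) / r \<le> u x"
        proof (rule le_u)
          fix p assume "p \<in> C"
          then have "u (r *\<^sub>R x) \<le> r * p x"
            using u_le[of p "r *\<^sub>R x"] sublinearD(2)[of p r x] CA r by auto
          then show "u (r *\<^sub>R x) / r \<le> p x" using r by (simp add: field_simps)
        qed
        then show "u (r *\<^sub>R x) \<le> r * u x" using r by (simp add: field_simps)
      qed
      moreover have "u \<le> q"
      proof -
        obtain p where "p \<in> C" using False by blast
        then have "u \<le> p" "p \<le> q" using u_le CA by (auto simp: le_fun_def)
        then show ?thesis by simp
      qed
      ultimately show ?thesis using u_le by (auto simp: le_fun_def)
    qed
  qed
  then show thesis using that by (auto intro: order_trans)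
qed

text \<open>
  By minimality \<open>tilt p y = p\<close> for every \<open>y\<close>. With step size \<open>1\<close> this reads
  \<open>p x + p y \<le> p (x + y)\<close>, the converse of subadditivity.
\<close>

lemma linear_if_minimal_sublinear:
  fixes p :: "'a::real_vector \<Rightarrow> real"
  assumes p: "sublinear p" and minimal: "\<And>p'. sublinear p' \<Longrightarrow> p' \<le> p \<Longrightarrow> p' = p"
  shows "linear p"
proof -
  have tilt: "tilt p y = p" for y
    using tilt_le_self[OF p] by (intro minimal sublinear_tilt p) (simp add: le_fun_def)
  have add: "p (x + y) = p x + p y" for x y
    using tilt_le[OF p, of 1 y x] sublinearD(1)[OF p, of x y] by (simp add: tilt)
  have uminus: "p (- x) = - p x" for x
    using add[of x "- x"] sublinearD(3)[OF p] by simp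
  have "p (r *\<^sub>R x) = r * p x" for r x
  proof (cases r "0::real" rule: linorder_cases)
    case less
    then have "p ((- r) *\<^sub>R x) = (- r) * p x" by (intro sublinearD(2)[OF p]) simp
    then show ?thesis by (simp add: uminus)
  next
    case equal
    then show ?thesis by (simp add: sublinearD(3)[OF p])
  next
    case greater
    then show ?thesis by (intro sublinearD(2)[OF p])
  qed
  with add show ?thesis by (intro linearI) auto
qed

text \<open>
  A minimal sublinear functional below \<open>tilt norm x\<close> is linear and at most the norm, hence bounded.
  Tilting has forced its value at \<open>- x\<close> down to \<open>- norm x\<close>, so it does not vanish at \<open>x\<close>.
\<close>

theorem ex_bounded_linear_nonzero:
  fixes x :: "'a::real_normed_vector"
  assumes "x \<noteq> 0"
  obtains u :: "'a \<Rightarrow> real" where "bounded_linear u" "u x \<noteq> 0"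
proof -
  obtain u :: "'a \<Rightarrow> real" where u: "sublinear u" "u \<le> tilt norm x"
      "\<And>p'. sublinear p' \<Longrightarrow> p' \<le> u \<Longrightarrow> p' = u"
    using ex_minimal_sublinear_le[OF sublinear_tilt[OF sublinear_norm, of x]] by blast
  have lin: "linear u" using u(1,3) by (rule linear_if_minimal_sublinear)
  have u_le: "u y \<le> norm y" for y
    using u(2) tilt_le_self[OF sublinear_norm, of x y] by (auto simp: le_fun_def intro: order_trans)
  have "\<bar>u y\<bar> \<le> norm y" for y
    using u_le[of y] u_le[of "- y"] linear_neg[OF lin, of y] by simp
  then have "bounded_linear u"
    using lin by (intro linear_conv_bounded_linear[THEN iffD1] bounded_linear_intro[of _ 1])
      (auto simp: linear_add linear_scale)
  moreover have "u (- x) \<le> - norm x"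
    using u(2) tilt_uminus_le[OF sublinear_norm, of x] by (auto simp: le_fun_def intro: order_trans)
  then have "u x \<noteq> 0" using assms linear_neg[OF lin, of x] by auto
  ultimately show thesis by (rule that)
qed

text \<open>
  Every real-linear functional on the field \<open>'k\<close> has the form \<open>c \<mapsto> inner 1 (a * c)\<close>, with \<open>a\<close>
  depending linearly on it: the pairing \<open>(a, c) \<mapsto> inner 1 (a * c)\<close> is nondegenerate, since \<open>c\<close> may
  be the inverse of \<open>a\<close>, and the dimension is finite. Over the complex numbers this is how a
  functional is recovered from its real part, here without identifying the field.
\<close>

lemma ex_representation_by_multiplication:
  obtains J :: "'k::{real_normed_field,euclidean_space} \<Rightarrow> 'k" where "linear J" "\<And>v c. inner 1 (J v * c) = inner v c"
proof -
  define M :: "'k \<Rightarrow> 'k" where "M a = (\<Sum>b\<in>Basis. inner 1 (a * b) *\<^sub>R b)" for a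
  have M: "inner (M a) c = inner 1 (a * c)" for a c
  proof -
    have "inner 1 (a * c) = inner 1 (a * (\<Sum>b\<in>Basis. inner c b *\<^sub>R b))"
      by (simp add: euclidean_representation)
    also have "\<dots> = (\<Sum>b\<in>Basis. inner c b * inner 1 (a * b))"
      by (simp add: sum_distrib_left inner_sum_right)
    also have "\<dots> = inner (M a) c"
      unfolding M_def inner_sum_left by (intro sum.cong) (auto simp: inner_commute)
    finally show ?thesis by simp
  qed
  have lin: "linear M"
    by (rule linearI) (auto simp: M_def algebra_simps inner_add_right sum.distrib scaleR_sum_right)
  have "a = 0" if "M a = 0" for a
  proof (rule ccontr)
    assume "a \<noteq> 0"
    then have "inner (M a) (inverse a) = inner (1::'k) 1" by (simp add: M)
    with that show False by simp
  qed
  then have "inj M" by (simp add: linear_injective_0[OF lin])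
  then obtain J where J: "linear J" "M \<circ> J = id"
    using linear_surjective_right_inverse[OF lin] linear_injective_imp_surjective[OF lin] by blast
  have "inner 1 (J v * c) = inner v c" for v c
    using J(2) by (simp flip: M) (metis comp_apply id_apply)
  with J(1) show thesis by (rule that)
qed

context normed_space_over
begin

lemma dual_iff:
  "f \<in> dual sc \<longleftrightarrow> (\<forall>x y. f (x + y) = f x + f y) \<and> (\<forall>c x. f (sc c x) = c * f x) \<and>
     (\<exists>K. \<forall>x. norm (f x) \<le> norm x * K)"
proof -
  have vs: "vector_space ((*) :: 'k \<Rightarrow> 'k \<Rightarrow> 'k)"
    by unfold_locales (auto simp: algebra_simps)
  show ?thesis (is "?l = ?r")
  proof
    assume ?l
    then show ?r
      using bounded_linear.bounded[of f]
      by (auto simp: dual_def Vector_Spaces.linear_iff)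
  next
    assume r: ?r
    then have "f (r *\<^sub>R x) = r *\<^sub>R f x" for r x
      by (simp add: scaleR_conv_of_real flip: scale_of_real)
    with r have "bounded_linear f"
      by (auto intro: bounded_linear_intro)
    with r show ?l
      using vs vector_space_axioms by (simp add: dual_def Vector_Spaces.linear_iff)
  qed
qed

text \<open>
  A real functional \<open>u\<close> that does not vanish at \<open>x\<close> turns into one over \<open>'k\<close> as follows: for each \<open>y\<close>
  the map \<open>c \<mapsto> u (c y)\<close> is real-linear on \<open>'k\<close>, so it equals \<open>c \<mapsto> inner 1 (f y * c)\<close> for a unique
  scalar \<open>f y\<close>; uniqueness makes \<open>f\<close> linear over \<open>'k\<close>.
\<close>

lemma dual_separates_points:
  assumes "x \<noteq> 0"
  obtains f where "f \<in> dual sc" "f x \<noteq> 0"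
proof -
  obtain u :: "'a \<Rightarrow> real" where u: "bounded_linear u" "u x \<noteq> 0"
    using ex_bounded_linear_nonzero[OF assms] .
  obtain J :: "'k \<Rightarrow> 'k" where J: "linear J" "\<And>v c. inner 1 (J v * c) = inner v c"
    using ex_representation_by_multiplication by blast
  define v :: "'a \<Rightarrow> 'k" where "v y = (\<Sum>b\<in>Basis. u (sc b y) *\<^sub>R b)" for y
  define f where "f = J \<circ> v"
  have sum_u: "u (\<Sum>b\<in>A. g b) = (\<Sum>b\<in>A. u (g b))" for A and g :: "'k \<Rightarrow> 'a"
    by (simp add: bounded_linear.linear linear_sum u(1))
  have f: "inner 1 (f y * c) = u (sc c y)" for y c
  proof -
    have "inner 1 (f y * c) = (\<Sum>b\<in>Basis. inner c b * u (sc b y))"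
      unfolding f_def comp_apply J(2)
      by (simp add: v_def inner_sum_right inner_commute mult.commute)
    also have "\<dots> = (\<Sum>b\<in>Basis. u (sc (inner c b *\<^sub>R b) y))"
      using linear_scale[OF bounded_linear.linear[OF u(1)]]
      by (simp add: scaleR_conv_of_real flip: scale_scale scale_of_real)
    also have "\<dots> = u (sc c y)"
      by (simp add: euclidean_representation flip: sum_u scale_sum_left)
    finally show ?thesis .
  qed
  have eqI: "a = a'" if *: "\<And>c. inner 1 (a * c) = inner 1 (a' * c)" for a a' :: 'k
  proof (rule ccontr)
    assume "a \<noteq> a'"
    moreover have "inner 1 ((a - a') * inverse (a - a')) = (0::real)"
      using *[of "inverse (a - a')"] by (simp add: left_diff_distrib inner_diff_right)
    ultimately show False by simp
  qed
  have u_add: "u (y + z) = u y + u z" for y z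
    using u(1) by (simp add: linear_add bounded_linear.linear)
  have add: "f (y + z) = f y + f z" for y z
    by (rule eqI) (simp add: f scale_right_distrib u_add distrib_right inner_add_right)
  have scale: "f (sc d y) = d * f y" for d y
    by (rule eqI) (metis f mult.assoc mult.commute scale_scale)
  obtain KJ where KJ: "\<And>v. norm (J v) \<le> norm v * KJ" "KJ > 0"
    using bounded_linear.pos_bounded[OF linear_conv_bounded_linear[THEN iffD1, OF J(1)]] by blast
  obtain Ku where Ku: "\<And>y. norm (u y) \<le> norm y * Ku"
    using bounded_linear.bounded[OF u(1)] by blast
  have "norm (f y) \<le> norm y * (real DIM('k) * Ku * KJ)" for y
  proof -
    have "norm (v y) \<le> (\<Sum>b\<in>Basis. norm (u (sc b y) *\<^sub>R b))"
      unfolding v_def by (rule norm_sum)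
    also have "\<dots> \<le> (\<Sum>b\<in>(Basis :: 'k set). norm y * Ku)"
    proof (rule sum_mono)
      fix b :: 'k assume "b \<in> Basis"
      then show "norm (u (sc b y) *\<^sub>R b) \<le> norm y * Ku"
        using Ku[of "sc b y"] by (simp add: norm_scale)
    qed
    finally have "norm (v y) * KJ \<le> norm y * (real DIM('k) * Ku) * KJ"
      using KJ(2) by (intro mult_right_mono) (auto simp: mult_ac)
    then show ?thesis using KJ(1)[of "v y"] by (simp add: f_def mult.assoc)
  qed
  then have "f \<in> dual sc" using add scale by (auto simp: dual_iff)
  moreover have "f x \<noteq> 0"
    using f[of x 1] u(2) by auto
  ultimately show thesis by (rule that)
qed

end

section \<open>Two consequences of compactness\<close>
context normed_space_over
begin

text \<open>
  All norms on a finite-dimensional space are equivalent, stated for a seminorm on the whole space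
  that is a norm on the span of \<open>B\<close>: as a continuous function of the coefficients it attains a
  positive minimum on the compact unit sphere of the \<open>\<ell>\<^sup>1\<close> norm.
\<close>

lemma seminorm_lower_bound:
  fixes p :: "'a \<Rightarrow> real"
  assumes add: "\<And>x y. p (x + y) \<le> p x + p y" and scale: "\<And>c x. p (sc c x) = norm c * p x"
    and B: "finite B" and indep: "\<And>u. p (\<Sum>b\<in>B. sc (u b) b) = 0 \<Longrightarrow> \<forall>b\<in>B. u b = 0"
  obtains \<delta> where "\<delta> > 0" "\<And>u. \<delta> * (\<Sum>b\<in>B. norm (u b)) \<le> p (\<Sum>b\<in>B. sc (u b) b)"
proof -
  define P where "P u = p (\<Sum>b\<in>B. sc (u b) b)" for u
  define N where "N u = (\<Sum>b\<in>B. norm (u b))" for u :: "'a \<Rightarrow> 'k"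
  have p0: "p 0 = 0" using scale[of 0 0] by simp
  have p_minus: "p (- x) = p x" for x using scale[of "- 1" x] by simp
  have p_nonneg: "0 \<le> p x" for x
    using add[of x "- x"] by (simp add: p0 p_minus)
  have p_sum: "p (\<Sum>b\<in>A. g b) \<le> (\<Sum>b\<in>A. p (g b))" for A and g :: "'a \<Rightarrow> 'a"
  proof (induction A rule: infinite_finite_induct)
    case (insert x F)
    then show ?case using add[of "g x" "sum g F"] by simp
  qed (auto simp: p0)
  have lipschitz: "\<bar>P u - P v\<bar> \<le> (\<Sum>b\<in>B. norm (u b - v b) * p b)" for u v
  proof -
    have diff: "p (x - y) \<ge> p x - p y" for x y using add[of "x - y" y] by simp
    have "\<bar>P u - P v\<bar> \<le> p ((\<Sum>b\<in>B. sc (u b) b) - (\<Sum>b\<in>B. sc (v b) b))"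
      using diff[of "\<Sum>b\<in>B. sc (u b) b" "\<Sum>b\<in>B. sc (v b) b"]
        diff[of "\<Sum>b\<in>B. sc (v b) b" "\<Sum>b\<in>B. sc (u b) b"]
        p_minus[of "(\<Sum>b\<in>B. sc (u b) b) - (\<Sum>b\<in>B. sc (v b) b)"]
      by (simp add: P_def)
    also have "(\<Sum>b\<in>B. sc (u b) b) - (\<Sum>b\<in>B. sc (v b) b) = (\<Sum>b\<in>B. sc (u b - v b) b)"
      by (simp add: scale_left_diff_distrib sum_subtractf)
    also have "p \<dots> \<le> (\<Sum>b\<in>B. norm (u b - v b) * p b)"
      using p_sum[of "\<lambda>b. sc (u b - v b) b" B] by (simp add: scale)
    finally show ?thesis .
  qed
  have cont_coord: "continuous_on UNIV (\<lambda>u :: 'a \<Rightarrow> 'k. u b)" for b by simp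
  have cont: "continuous_on UNIV P"
    unfolding continuous_on_def
  proof
    fix v :: "'a \<Rightarrow> 'k"
    have "((\<lambda>u. u b) \<longlongrightarrow> v b) (at v)" for b
      using cont_coord[of b] by (auto simp: continuous_on_def)
    then have "((\<lambda>u. \<Sum>b\<in>B. norm (u b - v b) * p b) \<longlongrightarrow> (\<Sum>b\<in>B. norm (v b - v b) * p b)) (at v)"
      by (intro tendsto_intros)
    then have "((\<lambda>u. \<Sum>b\<in>B. norm (u b - v b) * p b) \<longlongrightarrow> 0) (at v)" by simp
    then have "((\<lambda>u. P u - P v) \<longlongrightarrow> 0) (at v)"
      by (rule Lim_null_comparison[rotated]) (use lipschitz in \<open>simp add: always_eventually\<close>)
    then show "(P \<longlongrightarrow> P v) (at v within UNIV)" by (simp add: LIM_zero_iff)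
  qed
  show thesis
  proof (cases "B = {}")
    case True
    then show ?thesis using that[of 1] by (simp add: p0)
  next
    case False
    then obtain b0 where b0: "b0 \<in> B" by blast
    \<comment> \<open>The coefficients outside \<open>B\<close> are set to \<open>0\<close>; otherwise the sphere would not be compact.\<close>
    define Q where "Q = PiE UNIV (\<lambda>b. if b \<in> B then cball (0::'k) 1 else {0})"
    define S where "S = Q \<inter> {u. N u = 1}"
    have "compactin (product_topology (\<lambda>_. euclidean) UNIV) Q"
      unfolding Q_def by (subst compactin_PiE) auto
    then have "compact Q" by (simp add: euclidean_product_topology)
    moreover have "continuous_on UNIV N"
      unfolding N_def by (intro continuous_intros cont_coord)
    then have "closed {u. N u = 1}"
      by (intro closed_Collect_eq continuous_on_const)
    ultimately have "compact S" by (simp add: S_def compact_Int_closed)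
    moreover have "(\<lambda>b. if b = b0 then 1 else 0) \<in> S"
      using b0 B by (auto simp: S_def Q_def N_def if_distrib[of norm] cong: if_cong)
    then have "S \<noteq> {}" by blast
    ultimately obtain v where v: "v \<in> S" "\<And>u. u \<in> S \<Longrightarrow> P v \<le> P u"
      using continuous_attains_inf[of S P] continuous_on_subset[OF cont] by blast
    have "P v \<noteq> 0"
    proof
      assume "P v = 0"
      then have "N v = 0" using indep[of v] by (simp add: P_def N_def)
      with v(1) show False by (simp add: S_def)
    qed
    then have pos: "P v > 0" using p_nonneg by (simp add: P_def order_less_le)
    have "P v * N u \<le> P u" for u
    proof (cases "N u = 0")
      case True
      then show ?thesis using p_nonneg by (simp add: P_def)
    next
      case False
      then have N: "N u > 0" by (simp add: N_def sum_nonneg order_less_le)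
      define w where "w b = (if b \<in> B then u b / of_real (N u) else 0)" for b
      have "norm (u b) \<le> N u" if "b \<in> B" for b
        unfolding N_def using that B by (intro member_le_sum) auto
      then have "w \<in> Q" using N by (auto simp: Q_def w_def norm_divide)
      moreover have "N w = 1"
      proof -
        have "N w = (\<Sum>b\<in>B. norm (u b) / N u)"
          unfolding N_def[of w] using N by (intro sum.cong) (auto simp: w_def norm_divide)
        also have "\<dots> = N u / N u" unfolding N_def by (rule sum_divide_distrib[symmetric])
        finally show ?thesis using N by simp
      qed
      ultimately have "P v \<le> P w" by (intro v(2)) (simp add: S_def)
      also have "P w = P u / N u"
      proof -
        have "(\<Sum>b\<in>B. sc (w b) b) = sc (inverse (of_real (N u))) (\<Sum>b\<in>B. sc (u b) b)"
          by (simp add: w_def scale_sum_right divide_inverse mult.commute)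
        then have "P w = norm (inverse (of_real (N u) :: 'k)) * P u"
          by (simp add: P_def scale)
        also have "norm (inverse (of_real (N u) :: 'k)) = inverse (N u)"
          using N by (simp add: norm_inverse)
        finally show ?thesis by (simp add: divide_inverse mult.commute)
      qed
      finally show ?thesis using N by (simp add: field_simps)
    qed
    with pos show ?thesis by (intro that[of "P v"]) (auto simp: P_def N_def)
  qed
qed

end

text \<open>
  Compactness in terms of subnets. Passing to a finer filter \<open>G\<close> plays the role of passing to a
  subnet, so that the usual rules for limits apply along \<open>G\<close>.
\<close>

lemma compactin_imp_limit_along_finer_filter:
  assumes K: "compactin X K" and F: "F \<noteq> bot" and ev: "eventually (\<lambda>t. h t \<in> K) F"
  obtains w G where "G \<le> F" "G \<noteq> bot" "limitin X h w G"
proof -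
  define G where "G w = inf F (filtercomap h (nhdsin X w))" for w
  have "\<exists>w\<in>K. G w \<noteq> bot"
  proof (rule ccontr)
    assume *: "\<not> (\<exists>w\<in>K. G w \<noteq> bot)"
    have "\<exists>U. openin X U \<and> w \<in> U \<and> eventually (\<lambda>t. h t \<notin> U) F" if "w \<in> K" for w
    proof -
      have "eventually (\<lambda>_. False) (G w)" using * that by simp
      then obtain A V where A: "eventually A F" and V: "eventually V (nhdsin X w)"
          and disj: "\<And>t. A t \<Longrightarrow> V (h t) \<Longrightarrow> False"
        by (auto simp: G_def eventually_inf eventually_filtercomap)
      have "w \<in> topspace X" using that K compactin_subset_topspace by blast
      with V obtain U where U: "openin X U" "w \<in> U" "\<And>x. x \<in> U \<Longrightarrow> V x"
        by (auto simp: eventually_nhdsin)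
      from A have "eventually (\<lambda>t. h t \<notin> U) F"
        by (rule eventually_mono) (use disj U(3) in blast)
      with U show ?thesis by blast
    qed
    then obtain U where U: "\<And>w. w \<in> K \<Longrightarrow> openin X (U w) \<and> w \<in> U w \<and> eventually (\<lambda>t. h t \<notin> U w) F"
      by metis
    have "K \<subseteq> \<Union> (U ` K)" using U by blast
    then obtain \<F> where \<F>: "finite \<F>" "\<F> \<subseteq> U ` K" "K \<subseteq> \<Union>\<F>"
      using compactinD[OF K, of "U ` K"] U by auto
    have "eventually (\<lambda>t. \<forall>V\<in>\<F>. h t \<notin> V) F"
      using \<F> U by (intro eventually_ball_finite) auto
    with ev have "eventually (\<lambda>t. False) F"
      by eventually_elim (use \<F>(3) in blast)
    with F show False by simp
  qed
  then obtain w where w: "w \<in> K" "G w \<noteq> bot" by blast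
  have "limitin X h w (G w)"
    unfolding limitin_def
  proof (intro conjI allI impI)
    show "w \<in> topspace X" using w(1) K compactin_subset_topspace by blast
  next
    fix U assume "openin X U \<and> w \<in> U"
    then have "eventually (\<lambda>t. h t \<in> U) (filtercomap h (nhdsin X w))"
      by (intro eventually_filtercomapI) (auto simp: eventually_nhdsin)
    then show "eventually (\<lambda>t. h t \<in> U) (G w)"
      by (rule filter_leD[rotated]) (simp add: G_def)
  qed
  with w(2) show thesis by (intro that[of "G w"]) (auto simp: G_def)
qed

section \<open>The asymptotic norm of a bounded semigroup\<close>
locale bounded_linear_semigroup = normed_space_over sc
  for sc :: "'k::{real_normed_field,euclidean_space} \<Rightarrow> 'a::real_normed_vector \<Rightarrow> 'a" +
  fixes \<phi> :: "real \<Rightarrow> 'a \<Rightarrow> 'a"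
  assumes bounded_semigroup: "bounded_semigroup sc \<phi>"
begin

lemma
  assumes "t \<ge> 0"
  shows semigroup_add: "\<phi> t (x + y) = \<phi> t x + \<phi> t y"
    and semigroup_scale: "\<phi> t (sc c x) = sc c (\<phi> t x)"
    and semigroup_bounded_linear: "bounded_linear (\<phi> t)"
    and semigroup_comp: "q \<ge> 0 \<Longrightarrow> \<phi> t (\<phi> q x) = \<phi> (t + q) x"
proof -
  note sg = bounded_semigroup[unfolded bounded_semigroup_def]
  have "Vector_Spaces.linear sc sc (\<phi> t)" using sg assms by blast
  then show "\<phi> t (x + y) = \<phi> t x + \<phi> t y" and "\<phi> t (sc c x) = sc c (\<phi> t x)"
    by (simp_all add: Vector_Spaces.linear_iff)
  show "bounded_linear (\<phi> t)" using sg assms by blast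
  have "\<phi> t \<circ> \<phi> q = \<phi> (t + q)" if "q \<ge> 0"
    using sg assms that by blast
  then show "\<phi> t (\<phi> q x) = \<phi> (t + q) x" if "q \<ge> 0"
    using that by (metis comp_apply)
qed

lemma semigroup_sum: "t \<ge> 0 \<Longrightarrow> \<phi> t (\<Sum>i\<in>A. g i) = (\<Sum>i\<in>A. \<phi> t (g i))"
  by (simp add: linear_sum bounded_linear.linear semigroup_bounded_linear)

lemma semigroup_uniformly_bounded:
  obtains K where "K > 0" "\<And>t x. t \<ge> 0 \<Longrightarrow> norm (\<phi> t x) \<le> K * norm x"
proof -
  obtain C where C: "\<And>t. t \<ge> 0 \<Longrightarrow> onorm (\<phi> t) \<le> C"
    using bounded_semigroup unfolding bounded_semigroup_def by blast
  have "norm (\<phi> t x) \<le> max C 1 * norm x" if "t \<ge> 0" for t x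
  proof -
    have "norm (\<phi> t x) \<le> onorm (\<phi> t) * norm x"
      using that by (intro onorm semigroup_bounded_linear)
    also have "\<dots> \<le> max C 1 * norm x"
      using C[OF that] by (intro mult_right_mono) auto
    finally show ?thesis .
  qed
  then show thesis by (intro that[of "max C 1"]) auto
qed

text \<open>
  This is the limit superior of \<open>norm (\<phi> t x)\<close> for \<open>t \<rightarrow> \<infinity>\<close>. As a real number it is easiest to
  handle as the infimum of the eventual upper bounds.
\<close>

definition asymptotic_norm :: "'a \<Rightarrow> real" where
  "asymptotic_norm x = Inf {r. \<forall>\<^sub>F t in at_top. norm (\<phi> t x) \<le> r}"

lemma asymptotic_norm_le:
  assumes "\<forall>\<^sub>F t in at_top. norm (\<phi> t x) \<le> r"
  shows "asymptotic_norm x \<le> r"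
proof -
  have "0 \<le> s" if "\<forall>\<^sub>F t in at_top. norm (\<phi> t x) \<le> s" for s
    using eventually_happens[OF that] by (auto intro: order_trans[OF norm_ge_zero])
  then have "bdd_below {r. \<forall>\<^sub>F t in at_top. norm (\<phi> t x) \<le> r}" by (auto intro!: bdd_belowI)
  then show ?thesis
    unfolding asymptotic_norm_def using assms by (intro cInf_lower) auto
qed

lemma eventually_norm_le:
  assumes "asymptotic_norm x < r"
  shows "\<forall>\<^sub>F t in at_top. norm (\<phi> t x) \<le> r"
proof -
  obtain K where "\<And>t. t \<ge> 0 \<Longrightarrow> norm (\<phi> t x) \<le> K * norm x"
    using semigroup_uniformly_bounded by metis
  then have "\<forall>\<^sub>F t in at_top. norm (\<phi> t x) \<le> K * norm x"
    by (auto simp: eventually_at_top_linorder)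
  then have "{r. \<forall>\<^sub>F t in at_top. norm (\<phi> t x) \<le> r} \<noteq> {}" by blast
  from cInf_lessD[OF this assms[unfolded asymptotic_norm_def]]
  obtain s where "\<forall>\<^sub>F t in at_top. norm (\<phi> t x) \<le> s" "s < r" by auto
  then show ?thesis by (auto elim: eventually_mono)
qed

lemma asymptotic_norm_nonneg: "0 \<le> asymptotic_norm x"
proof (rule ccontr)
  assume "\<not> 0 \<le> asymptotic_norm x"
  then obtain r where r: "asymptotic_norm x < r" "r < 0"
    using dense[of "asymptotic_norm x" 0] by auto
  obtain t where "norm (\<phi> t x) \<le> r"
    using eventually_happens[OF eventually_norm_le[OF r(1)]] by auto
  with r(2) norm_ge_zero[of "\<phi> t x"] show False by linarith
qed

lemma asymptotic_norm_add: "asymptotic_norm (x + y) \<le> asymptotic_norm x + asymptotic_norm y"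
proof (rule field_le_epsilon)
  fix e :: real assume e: "e > 0"
  have "\<forall>\<^sub>F t in at_top. norm (\<phi> t x) \<le> asymptotic_norm x + e / 2"
    and "\<forall>\<^sub>F t in at_top. norm (\<phi> t y) \<le> asymptotic_norm y + e / 2"
    using e by (auto intro: eventually_norm_le)
  then have "\<forall>\<^sub>F t in at_top. norm (\<phi> t (x + y)) \<le> asymptotic_norm x + asymptotic_norm y + e"
    using eventually_ge_at_top[of "0::real"]
  proof eventually_elim
    case (elim t)
    then show ?case
      using norm_triangle_ineq[of "\<phi> t x" "\<phi> t y"] by (simp add: semigroup_add)
  qed
  then show "asymptotic_norm (x + y) \<le> asymptotic_norm x + asymptotic_norm y + e"
    by (rule asymptotic_norm_le)
qed

lemma asymptotic_norm_scale: "asymptotic_norm (sc c x) = norm c * asymptotic_norm x"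
proof -
  have le: "asymptotic_norm (sc c x) \<le> norm c * asymptotic_norm x" if c: "c \<noteq> 0" for c x
  proof (rule field_le_epsilon)
    fix e :: real assume e: "e > 0"
    then have "\<forall>\<^sub>F t in at_top. norm (\<phi> t x) \<le> asymptotic_norm x + e / norm c"
      using c by (auto intro: eventually_norm_le)
    then have "\<forall>\<^sub>F t in at_top. norm (\<phi> t (sc c x)) \<le> norm c * asymptotic_norm x + e"
      using eventually_ge_at_top[of "0::real"]
    proof eventually_elim
      case (elim t)
      then show ?case
        using mult_left_mono[OF elim(1), of "norm c"] c
        by (simp add: semigroup_scale norm_scale distrib_left)
    qed
    then show "asymptotic_norm (sc c x) \<le> norm c * asymptotic_norm x + e"
      by (rule asymptotic_norm_le)
  qed
  show ?thesis
  proof (cases "c = 0")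
    case True
    have "\<forall>\<^sub>F t in at_top. norm (\<phi> t 0) \<le> 0"
      using eventually_ge_at_top[of "0::real"]
      by eventually_elim (simp add: linear_0 bounded_linear.linear semigroup_bounded_linear)
    then have "asymptotic_norm 0 \<le> 0" by (rule asymptotic_norm_le)
    then show ?thesis using True asymptotic_norm_nonneg[of 0] by simp
  next
    case False
    have "asymptotic_norm x \<le> norm (inverse c) * asymptotic_norm (sc c x)"
      using le[of "inverse c" "sc c x"] False by simp
    then have "norm c * asymptotic_norm x \<le> norm c * (norm (inverse c) * asymptotic_norm (sc c x))"
      by (rule mult_left_mono) simp
    also have "\<dots> = asymptotic_norm (sc c x)" using False by (simp add: norm_inverse)
    finally have "norm c * asymptotic_norm x \<le> asymptotic_norm (sc c x)" .
    with le[OF False, of x] show ?thesis by simp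
  qed
qed

lemma asymptotic_norm_eq_0_iff: "asymptotic_norm x = 0 \<longleftrightarrow> x \<in> null_space \<phi>"
proof
  assume *: "asymptotic_norm x = 0"
  have "\<forall>\<^sub>F t in at_top. norm (\<phi> t x) < e" if "e > 0" for e
  proof -
    have "\<forall>\<^sub>F t in at_top. norm (\<phi> t x) \<le> e / 2"
      using that * by (intro eventually_norm_le) simp
    then show ?thesis by (rule eventually_mono) (use that in auto)
  qed
  then show "x \<in> null_space \<phi>" by (simp add: null_space_def tendsto_iff)
next
  assume *: "x \<in> null_space \<phi>"
  have "asymptotic_norm x \<le> 0"
  proof (rule field_le_epsilon)
    fix e :: real assume "e > 0"
    with * have "\<forall>\<^sub>F t in at_top. norm (\<phi> t x) < e" by (simp add: null_space_def tendsto_iff)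
    then show "asymptotic_norm x \<le> 0 + e"
      by (intro asymptotic_norm_le) (auto elim: eventually_mono)
  qed
  then show "asymptotic_norm x = 0" using asymptotic_norm_nonneg[of x] by simp
qed

text \<open>
  The limit superior does not see a shift in time. The estimates below that hold uniformly in time
  rest on this invariance.
\<close>

lemma asymptotic_norm_shift:
  assumes T: "T \<ge> 0"
  shows "asymptotic_norm (\<phi> T x) = asymptotic_norm x"
proof -
  have "(\<forall>\<^sub>F t in at_top. norm (\<phi> t (\<phi> T x)) \<le> r) \<longleftrightarrow> (\<forall>\<^sub>F t in at_top. norm (\<phi> t x) \<le> r)" for r
  proof -
    have "(\<forall>\<^sub>F t in at_top. norm (\<phi> t (\<phi> T x)) \<le> r) \<longleftrightarrow> (\<forall>\<^sub>F t in at_top. norm (\<phi> (t + T) x) \<le> r)"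
      by (intro eventually_cong eventually_mono[OF eventually_ge_at_top[of "0::real"]])
        (auto simp: semigroup_comp T)
    also have "\<dots> \<longleftrightarrow> (\<forall>\<^sub>F t in at_top. norm (\<phi> t x) \<le> r)"
    proof
      assume "\<forall>\<^sub>F t in at_top. norm (\<phi> (t + T) x) \<le> r"
      then obtain N where "\<And>t. t \<ge> N \<Longrightarrow> norm (\<phi> (t + T) x) \<le> r"
        by (auto simp: eventually_at_top_linorder)
      from this[of "_ - T"] show "\<forall>\<^sub>F t in at_top. norm (\<phi> t x) \<le> r"
        unfolding eventually_at_top_linorder by (intro exI[of _ "N + T"]) simp
    next
      assume "\<forall>\<^sub>F t in at_top. norm (\<phi> t x) \<le> r"
      then show "\<forall>\<^sub>F t in at_top. norm (\<phi> (t + T) x) \<le> r"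
        using T unfolding eventually_at_top_linorder by (meson add_increasing2)
    qed
    finally show ?thesis .
  qed
  then show ?thesis by (simp add: asymptotic_norm_def)
qed

text \<open>
  A point of the orbit controls the whole later orbit, because the operators are uniformly bounded.
  So an orbit that comes close to \<open>0\<close> once stays close to \<open>0\<close>.
\<close>

lemma asymptotic_norm_le_orbit:
  obtains K where "K > 0" "\<And>t x. t \<ge> 0 \<Longrightarrow> asymptotic_norm x \<le> K * norm (\<phi> t x)"
proof -
  obtain K where K: "K > 0" "\<And>t x. t \<ge> 0 \<Longrightarrow> norm (\<phi> t x) \<le> K * norm x"
    using semigroup_uniformly_bounded by blast
  have "asymptotic_norm x \<le> K * norm x" for x
    using K(2) by (intro asymptotic_norm_le) (auto simp: eventually_at_top_linorder)
  then have "asymptotic_norm x \<le> K * norm (\<phi> t x)" if "t \<ge> 0" for t x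
    using asymptotic_norm_shift[OF that, of x] by metis
  with K(1) show thesis by (rule that)
qed

lemma asymptotic_norm_sum: "asymptotic_norm (\<Sum>i\<in>A. g i) \<le> (\<Sum>i\<in>A. asymptotic_norm (g i))"
proof (induction A rule: infinite_finite_induct)
  case (insert i A)
  then show ?case using asymptotic_norm_add[of "g i" "sum g A"] by simp
qed (use asymptotic_norm_scale[of 0 0] in auto)

lemma subspace_null_space: "subspace (null_space \<phi>)"
proof (rule subspaceI)
  show "0 \<in> null_space \<phi>"
    using asymptotic_norm_scale[of 0 0] by (simp flip: asymptotic_norm_eq_0_iff)
next
  fix x y assume "x \<in> null_space \<phi>" "y \<in> null_space \<phi>"
  then show "x + y \<in> null_space \<phi>"
    using asymptotic_norm_add[of x y] asymptotic_norm_nonneg[of "x + y"]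
    by (simp flip: asymptotic_norm_eq_0_iff)
next
  fix c x assume "x \<in> null_space \<phi>"
  then show "sc c x \<in> null_space \<phi>"
    by (simp add: asymptotic_norm_scale flip: asymptotic_norm_eq_0_iff)
qed

end

section \<open>Coordinates modulo the null space\<close>

locale complemented_null_space = bounded_linear_semigroup sc \<phi>
  for sc :: "'k::{real_normed_field,euclidean_space} \<Rightarrow> 'a::real_normed_vector \<Rightarrow> 'a"
    and \<phi> :: "real \<Rightarrow> 'a \<Rightarrow> 'a" +
  fixes B :: "'a set"
  assumes finite_B: "finite B" and independent_B: "independent B"
    and direct_sum: "is_direct_sum sc (null_space \<phi>) (span B)"
begin

lemma combination_in_null_space_iff:
  "(\<Sum>b\<in>B. sc (u b) b) \<in> null_space \<phi> \<longleftrightarrow> (\<forall>b\<in>B. u b = 0)"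
proof
  assume "(\<Sum>b\<in>B. sc (u b) b) \<in> null_space \<phi>"
  moreover have "(\<Sum>b\<in>B. sc (u b) b) \<in> span B"
    by (intro span_sum span_scale span_base)
  ultimately have "(\<Sum>b\<in>B. sc (u b) b) = 0"
    using direct_sum by (auto simp: is_direct_sum_def)
  then show "\<forall>b\<in>B. u b = 0"
    using independent_B finite_B dependent_finite[of B] by blast
qed (use subspace_0[OF subspace_null_space] in simp)

text \<open>
  The coordinates with respect to \<open>B\<close> of the projection along the null space. Only the values at the
  elements of \<open>B\<close> are determined.
\<close>

definition coord :: "'a \<Rightarrow> 'a \<Rightarrow> 'k" where
  "coord x = (SOME u. x - (\<Sum>b\<in>B. sc (u b) b) \<in> null_space \<phi>)"

lemma minus_coord_in_null_space: "x - (\<Sum>b\<in>B. sc (coord x b) b) \<in> null_space \<phi>"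
proof -
  obtain a y where ay: "a \<in> null_space \<phi>" "y \<in> span B" "x = a + y"
    using direct_sum unfolding is_direct_sum_def by blast
  then obtain u where "y = (\<Sum>b\<in>B. sc (u b) b)"
    using span_finite[OF finite_B] by auto
  with ay have "x - (\<Sum>b\<in>B. sc (u b) b) \<in> null_space \<phi>" by simp
  then show ?thesis
    unfolding coord_def by (rule someI[of "\<lambda>u. x - (\<Sum>b\<in>B. sc (u b) b) \<in> null_space \<phi>"])
qed

lemma coord_unique:
  assumes "x - (\<Sum>b\<in>B. sc (u b) b) \<in> null_space \<phi>" and "b \<in> B"
  shows "coord x b = u b"
proof -
  have "(x - (\<Sum>b\<in>B. sc (u b) b)) - (x - (\<Sum>b\<in>B. sc (coord x b) b)) \<in> null_space \<phi>"
    by (intro subspace_diff subspace_null_space assms minus_coord_in_null_space)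
  then have "(\<Sum>b\<in>B. sc (coord x b - u b) b) \<in> null_space \<phi>"
    by (simp add: scale_left_diff_distrib sum_subtractf)
  then show ?thesis using assms(2) by (auto simp: combination_in_null_space_iff)
qed

lemma coord_eq_0_iff: "(\<forall>b\<in>B. coord x b = 0) \<longleftrightarrow> x \<in> null_space \<phi>"
proof
  assume "\<forall>b\<in>B. coord x b = 0"
  then show "x \<in> null_space \<phi>" using minus_coord_in_null_space[of x] by simp
next
  assume "x \<in> null_space \<phi>"
  then show "\<forall>b\<in>B. coord x b = 0" using coord_unique[of x "\<lambda>_. 0"] by simp
qed

lemma coord_combination: "b \<in> B \<Longrightarrow> coord (\<Sum>b\<in>B. sc (u b) b) b = u b"
  by (rule coord_unique) (use subspace_0[OF subspace_null_space] in simp_all)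

lemma
  assumes b: "b \<in> B"
  shows coord_add: "coord (x + y) b = coord x b + coord y b"
    and coord_scale: "coord (sc c x) b = c * coord x b"
proof -
  have "(x - (\<Sum>b\<in>B. sc (coord x b) b)) + (y - (\<Sum>b\<in>B. sc (coord y b) b)) \<in> null_space \<phi>"
    by (intro subspace_add subspace_null_space minus_coord_in_null_space)
  then have "x + y - (\<Sum>b\<in>B. sc (coord x b + coord y b) b) \<in> null_space \<phi>"
    by (simp add: scale_left_distrib sum.distrib algebra_simps)
  then show "coord (x + y) b = coord x b + coord y b" by (rule coord_unique) (rule b)
  have "sc c (x - (\<Sum>b\<in>B. sc (coord x b) b)) \<in> null_space \<phi>"
    by (intro subspace_scale subspace_null_space minus_coord_in_null_space)
  then have "sc c x - (\<Sum>b\<in>B. sc (c * coord x b) b) \<in> null_space \<phi>"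
    by (simp add: scale_right_diff_distrib scale_sum_right)
  then show "coord (sc c x) b = c * coord x b" by (rule coord_unique) (rule b)
qed

lemma asymptotic_norm_combination_coord:
  "asymptotic_norm (\<Sum>b\<in>B. sc (coord x b) b) = asymptotic_norm x"
proof (rule antisym)
  let ?y = "\<Sum>b\<in>B. sc (coord x b) b"
  have 0: "asymptotic_norm (x - ?y) = 0" "asymptotic_norm (?y - x) = 0"
    using minus_coord_in_null_space[of x] subspace_neg[OF subspace_null_space, of "x - ?y"]
    by (simp_all add: asymptotic_norm_eq_0_iff)
  show "asymptotic_norm ?y \<le> asymptotic_norm x"
    using asymptotic_norm_add[of x "?y - x"] 0(2) by simp
  show "asymptotic_norm x \<le> asymptotic_norm ?y"
    using asymptotic_norm_add[of ?y "x - ?y"] 0(1) by simp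
qed

lemma asymptotic_norm_le_coord:
  "asymptotic_norm x \<le> (\<Sum>b\<in>B. norm (coord x b) * asymptotic_norm b)"
  using asymptotic_norm_sum[of "\<lambda>b. sc (coord x b) b" B]
  by (simp add: asymptotic_norm_combination_coord asymptotic_norm_scale)

text \<open>
  The asymptotic norm ignores the null space and vanishes nowhere else, so on the span of \<open>B\<close> it is
  a norm on a finite-dimensional space.
\<close>

lemma coord_bounded_by_asymptotic_norm:
  obtains M where "M > 0" "\<And>x. (\<Sum>b\<in>B. norm (coord x b)) \<le> M * asymptotic_norm x"
proof -
  obtain \<delta> where \<delta>: "\<delta> > 0"
      "\<And>u. \<delta> * (\<Sum>b\<in>B. norm (u b)) \<le> asymptotic_norm (\<Sum>b\<in>B. sc (u b) b)"
  proof (rule seminorm_lower_bound[of asymptotic_norm B])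
    show "\<forall>b\<in>B. u b = 0" if "asymptotic_norm (\<Sum>b\<in>B. sc (u b) b) = 0" for u
      using that by (simp add: asymptotic_norm_eq_0_iff combination_in_null_space_iff)
  qed (use asymptotic_norm_add asymptotic_norm_scale finite_B in blast)+
  have "(\<Sum>b\<in>B. norm (coord x b)) \<le> inverse \<delta> * asymptotic_norm x" for x
    using \<delta>(2)[of "coord x"] \<delta>(1) by (simp add: asymptotic_norm_combination_coord field_simps)
  with \<delta>(1) show thesis by (intro that[of "inverse \<delta>"]) simp_all
qed

text \<open>
  The constant does not depend on \<open>t\<close>: vectors of the complement are not contracted by more than a
  fixed factor. For \<open>t = 0\<close> the same estimate gives continuity of the coordinates.
\<close>

lemma coord_bounded_by_orbit:
  obtains M where "M > 0" "\<And>x t. t \<ge> 0 \<Longrightarrow> (\<Sum>b\<in>B. norm (coord x b)) \<le> M * norm (\<phi> t x)"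
proof -
  obtain M where M: "M > 0" "\<And>x. (\<Sum>b\<in>B. norm (coord x b)) \<le> M * asymptotic_norm x"
    using coord_bounded_by_asymptotic_norm by blast
  obtain K where K: "K > 0" "\<And>t x. t \<ge> 0 \<Longrightarrow> asymptotic_norm x \<le> K * norm (\<phi> t x)"
    using asymptotic_norm_le_orbit by blast
  have "(\<Sum>b\<in>B. norm (coord x b)) \<le> M * K * norm (\<phi> t x)" if "t \<ge> 0" for x t
    using order_trans[OF M(2)[of x] mult_left_mono[OF K(2)[OF that, of x]]] M(1) by (simp add: mult.assoc)
  with M(1) K(1) show thesis by (intro that[of "M * K"]) simp_all
qed

lemma coord_in_dual:
  assumes b: "b \<in> B"
  shows "(\<lambda>x. coord x b) \<in> dual sc"
proof -
  obtain M where M: "M > 0" "\<And>x t. t \<ge> 0 \<Longrightarrow> (\<Sum>b\<in>B. norm (coord x b)) \<le> M * norm (\<phi> t x)"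
    using coord_bounded_by_orbit by blast
  obtain K where K: "K > 0" "\<And>t x. t \<ge> 0 \<Longrightarrow> norm (\<phi> t x) \<le> K * norm x"
    using semigroup_uniformly_bounded by blast
  have "norm (coord x b) \<le> norm x * (M * K)" for x
  proof -
    have "norm (coord x b) \<le> (\<Sum>b\<in>B. norm (coord x b))"
      using b finite_B by (intro member_le_sum) auto
    also have "\<dots> \<le> M * norm (\<phi> 0 x)" by (rule M(2)) simp
    also have "\<dots> \<le> M * (K * norm x)" using K(2)[of 0 x] M(1) by (intro mult_left_mono) auto
    finally show ?thesis by (simp add: mult_ac)
  qed
  then show ?thesis using coord_add[OF b] coord_scale[OF b] by (auto simp: dual_iff)
qed

end

section \<open>The weak limit of the semigroup\<close>

locale weak_limit_of_basis = complemented_null_space sc \<phi> B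
  for sc :: "'k::{real_normed_field,euclidean_space} \<Rightarrow> 'a::real_normed_vector \<Rightarrow> 'a"
    and \<phi> :: "real \<Rightarrow> 'a \<Rightarrow> 'a" and B :: "'a set" +
  fixes G :: "real filter" and w :: "'a \<Rightarrow> 'a"
  assumes G_le: "G \<le> at_top" and G_nontrivial: "G \<noteq> bot"
    and weak_limit_basis: "\<And>b f. b \<in> B \<Longrightarrow> f \<in> dual sc \<Longrightarrow> ((\<lambda>t. f (\<phi> t b)) \<longlongrightarrow> f (w b)) G"
begin

text \<open>
  The limit of \<open>\<phi> t\<close> along \<open>G\<close> in the weak operator topology: it is prescribed on \<open>B\<close>, and on the null
  space it is \<open>0\<close>.
\<close>

definition limit_operator :: "'a \<Rightarrow> 'a" where
  "limit_operator x = (\<Sum>b\<in>B. sc (coord x b) (w b))"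

lemma limit_operator_add: "limit_operator (x + y) = limit_operator x + limit_operator y"
  by (simp add: limit_operator_def coord_add scale_left_distrib sum.distrib)

lemma limit_operator_scale: "limit_operator (sc c x) = sc c (limit_operator x)"
  by (simp add: limit_operator_def coord_scale scale_sum_right)

lemma eventually_nonneg: "\<forall>\<^sub>F t in G. 0 \<le> t"
  using G_le eventually_ge_at_top[of "0::real"] by (rule filter_leD)

lemma weak_limit:
  assumes f: "f \<in> dual sc"
  shows "((\<lambda>t. f (\<phi> t x)) \<longlongrightarrow> f (limit_operator x)) G"
proof -
  define z where "z = x - (\<Sum>b\<in>B. sc (coord x b) b)"
  have f_add: "f (a + a') = f a + f a'" and f_scale: "f (sc c a) = c * f a" for a a' c
    using f by (auto simp: dual_iff)
  have f_bl: "bounded_linear f" using f by (simp add: dual_def)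
  have f_sum: "f (\<Sum>i\<in>A. g i) = (\<Sum>i\<in>A. f (g i))" for A and g :: "'a \<Rightarrow> 'a"
    by (simp add: linear_sum bounded_linear.linear f_bl)
  have "((\<lambda>t. \<phi> t z) \<longlongrightarrow> 0) G"
    using minus_coord_in_null_space[of x] tendsto_mono[OF G_le] by (simp add: z_def null_space_def)
  then have "((\<lambda>t. f (\<phi> t z)) \<longlongrightarrow> f 0) G"
    by (rule bounded_linear.tendsto[OF f_bl])
  then have z_lim: "((\<lambda>t. f (\<phi> t z)) \<longlongrightarrow> 0) G"
    by (simp add: linear_0 bounded_linear.linear f_bl)
  have "((\<lambda>t. (\<Sum>b\<in>B. coord x b * f (\<phi> t b)) + f (\<phi> t z)) \<longlongrightarrow> (\<Sum>b\<in>B. coord x b * f (w b)) + 0) G"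
    by (intro tendsto_intros weak_limit_basis f z_lim)
  then have "((\<lambda>t. (\<Sum>b\<in>B. coord x b * f (\<phi> t b)) + f (\<phi> t z)) \<longlongrightarrow> f (limit_operator x)) G"
    by (simp add: limit_operator_def f_sum f_scale)
  moreover have "\<forall>\<^sub>F t in G. (\<Sum>b\<in>B. coord x b * f (\<phi> t b)) + f (\<phi> t z) = f (\<phi> t x)"
    using eventually_nonneg
  proof eventually_elim
    case (elim t)
    have "\<phi> t ((\<Sum>b\<in>B. sc (coord x b) b) + z) = (\<Sum>b\<in>B. sc (coord x b) (\<phi> t b)) + \<phi> t z"
      using elim by (simp add: semigroup_add semigroup_sum semigroup_scale)
    then show ?case by (simp add: z_def f_add f_sum f_scale)
  qed
  ultimately show ?thesis by (rule Lim_transform_eventually)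
qed

text \<open>
  Both sides are weak limits of \<open>\<phi> (s + t) x\<close>. The left one is, since a continuous operator is also
  weakly continuous, and weak limits are unique because the dual separates points.
\<close>

lemma semigroup_limit_operator:
  assumes s: "s \<ge> 0"
  shows "\<phi> s (limit_operator x) = limit_operator (\<phi> s x)"
proof (rule ccontr)
  assume "\<phi> s (limit_operator x) \<noteq> limit_operator (\<phi> s x)"
  then obtain f where f: "f \<in> dual sc" "f (\<phi> s (limit_operator x) - limit_operator (\<phi> s x)) \<noteq> 0"
    using dual_separates_points by (metis right_minus_eq)
  have "bounded_linear (\<lambda>y. f (\<phi> s y))"
    using f(1) semigroup_bounded_linear[OF s]
    by (auto simp: dual_def intro: bounded_linear_compose)
  then have "(\<lambda>y. f (\<phi> s y)) \<in> dual sc"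
    using f(1) s by (auto simp: dual_iff semigroup_add semigroup_scale dest: bounded_linear.bounded)
  then have "((\<lambda>t. f (\<phi> s (\<phi> t x))) \<longlongrightarrow> f (\<phi> s (limit_operator x))) G"
    by (rule weak_limit)
  moreover have "\<forall>\<^sub>F t in G. f (\<phi> s (\<phi> t x)) = f (\<phi> t (\<phi> s x))"
    using eventually_nonneg by eventually_elim (simp add: semigroup_comp s add.commute)
  ultimately have "((\<lambda>t. f (\<phi> t (\<phi> s x))) \<longlongrightarrow> f (\<phi> s (limit_operator x))) G"
    by (rule Lim_transform_eventually)
  then have "f (\<phi> s (limit_operator x)) = f (limit_operator (\<phi> s x))"
    using weak_limit[OF f(1)] tendsto_unique[OF G_nontrivial] by blast
  moreover have "linear f" using f(1) by (simp add: dual_def bounded_linear.linear)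
  ultimately show False using f(2) by (simp add: linear_diff)
qed

text \<open>
  If the weak limit lies in the null space, then the finitely many coordinates of \<open>\<phi> t x\<close>, which are
  continuous functionals, tend to \<open>0\<close> along \<open>G\<close>. They dominate the asymptotic norm of \<open>\<phi> t x\<close>, which
  does not depend on \<open>t\<close>; hence it is \<open>0\<close>.
\<close>

lemma limit_operator_in_null_space_iff: "limit_operator x \<in> null_space \<phi> \<longleftrightarrow> x \<in> null_space \<phi>"
proof
  assume "x \<in> null_space \<phi>"
  then have "limit_operator x = 0" by (simp add: limit_operator_def flip: coord_eq_0_iff)
  then show "limit_operator x \<in> null_space \<phi>" by (simp add: subspace_0[OF subspace_null_space])
next
  assume "limit_operator x \<in> null_space \<phi>"
  then have "((\<lambda>t. coord (\<phi> t x) b) \<longlongrightarrow> 0) G" if "b \<in> B" for b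
    using weak_limit[OF coord_in_dual[OF that], of x] that by (simp flip: coord_eq_0_iff)
  then have "((\<lambda>t. \<Sum>b\<in>B. norm (coord (\<phi> t x) b) * asymptotic_norm b) \<longlongrightarrow> (\<Sum>b\<in>B. 0 * asymptotic_norm b)) G"
    by (intro tendsto_intros tendsto_norm_zero) auto
  moreover have "\<forall>\<^sub>F t in G. asymptotic_norm x \<le> (\<Sum>b\<in>B. norm (coord (\<phi> t x) b) * asymptotic_norm b)"
    using eventually_nonneg
    by eventually_elim (use asymptotic_norm_le_coord in \<open>metis asymptotic_norm_shift\<close>)
  ultimately have "asymptotic_norm x \<le> (\<Sum>b\<in>B. 0 * asymptotic_norm b)"
    by (intro tendsto_le[OF G_nontrivial _ tendsto_const])
  then show "x \<in> null_space \<phi>"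
    using asymptotic_norm_nonneg[of x] by (simp flip: asymptotic_norm_eq_0_iff)
qed

text \<open>
  Modulo the null space, the limit operator is an injective map of a finite-dimensional space into
  itself, hence surjective. Here \<open>R\<close> is that map, with the quotient represented by the span of \<open>B\<close>.
\<close>

lemma ex_limit_operator_congruent: "\<exists>y. x - limit_operator y \<in> null_space \<phi>"
proof -
  define R where "R y = (\<Sum>b\<in>B. sc (coord (limit_operator y) b) b)" for y
  have R_congruent: "limit_operator y - R y \<in> null_space \<phi>" for y
    unfolding R_def by (rule minus_coord_in_null_space)
  interpret R: Vector_Spaces.linear sc sc R
    using vector_space_axioms
    by (simp add: Vector_Spaces.linear_iff R_def limit_operator_add limit_operator_scale coord_add coord_scale
        scale_left_distrib sum.distrib scale_sum_right)
  have R_span: "R y \<in> span B" for y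
    unfolding R_def by (intro span_sum span_scale span_base)
  have inj: "inj_on R (span B)"
  proof (subst R.inj_on_iff_eq_0)
    show "subspace (span B)" by (rule subspace_span)
    show "\<forall>y\<in>span B. R y = 0 \<longrightarrow> y = 0"
    proof (intro ballI impI)
      fix y assume y: "y \<in> span B" "R y = 0"
      then have "y \<in> null_space \<phi>"
        using R_congruent[of y] by (simp add: limit_operator_in_null_space_iff)
      with y(1) show "y = 0" using direct_sum by (auto simp: is_direct_sum_def)
    qed
  qed
  have indep: "independent (R ` B)"
    using independent_B inj by (rule R.independent_injective_image)
  have card: "card (R ` B) = card B"
    by (intro card_image inj_on_subset[OF inj] span_superset)
  have "B \<subseteq> span (R ` B)"
  proof (rule ccontr)
    assume "\<not> B \<subseteq> span (R ` B)"
    then obtain b where b: "b \<in> B" "b \<notin> span (R ` B)" by blast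
    then have "independent (insert b (R ` B))"
      using indep by (intro independent_insertI)
    moreover have "insert b (R ` B) \<subseteq> span B"
      using b(1) R_span span_base by auto
    ultimately have "card (insert b (R ` B)) \<le> card B"
      using independent_span_bound[OF finite_B] by blast
    moreover have "b \<notin> R ` B" using b(2) span_base by blast
    ultimately show False using card finite_B by simp
  qed
  then have "B \<subseteq> R ` span B" by (simp add: R.span_image)
  then have "span B \<subseteq> R ` span B"
    by (intro span_minimal) (auto intro: R.subspace_image)
  moreover have "(\<Sum>b\<in>B. sc (coord x b) b) \<in> span B"
    by (intro span_sum span_scale span_base)
  ultimately obtain y where y: "(\<Sum>b\<in>B. sc (coord x b) b) = R y" by blast
  have "(x - (\<Sum>b\<in>B. sc (coord x b) b)) - (limit_operator y - R y) \<in> null_space \<phi>"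
    by (intro subspace_diff subspace_null_space minus_coord_in_null_space R_congruent)
  then show ?thesis by (auto simp: y)
qed

lemma subspace_range_limit_operator: "subspace (range limit_operator)"
proof (rule subspaceI)
  show "0 \<in> range limit_operator"
    by (rule range_eqI[of _ _ 0]) (use limit_operator_scale[of 0 0] in simp)
qed (auto simp flip: limit_operator_add limit_operator_scale)

lemma invariant_range_limit_operator: "invariant \<phi> (range limit_operator)"
  by (auto simp: invariant_def semigroup_limit_operator)

lemma direct_sum_range_limit_operator: "is_direct_sum sc (null_space \<phi>) (range limit_operator)"
  unfolding is_direct_sum_def
proof (intro conjI allI subspace_null_space subspace_range_limit_operator)
  have "limit_operator x = 0" if "limit_operator x \<in> null_space \<phi>" for x
    using that unfolding limit_operator_in_null_space_iff by (simp add: limit_operator_def flip: coord_eq_0_iff)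
  then show "null_space \<phi> \<inter> range limit_operator = {0}"
    using subspace_0[OF subspace_null_space] subspace_0[OF subspace_range_limit_operator] by auto
next
  fix x
  obtain y where "x - limit_operator y \<in> null_space \<phi>" using ex_limit_operator_congruent by blast
  then show "\<exists>a\<in>null_space \<phi>. \<exists>b\<in>range limit_operator. x = a + b"
    by (metis diff_add_cancel rangeI)
qed

text \<open>
  Each \<open>b\<close> in \<open>B\<close> is compared with a vector \<open>z b\<close> of the invariant subspace. The coefficients of a unit
  vector of \<open>\<phi> T ` span B\<close> are bounded by \<open>M\<close> for all \<open>T\<close>, so only the differences \<open>b - z b\<close> matter.
\<close>

lemma deviation_le:
  assumes M: "\<And>x t. t \<ge> 0 \<Longrightarrow> (\<Sum>b\<in>B. norm (coord x b)) \<le> M * norm (\<phi> t x)"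
    and z: "\<And>b. b \<in> B \<Longrightarrow> z b \<in> range limit_operator" and T: "T \<ge> 0" and "M \<ge> 0"
  shows "deviation (\<phi> T ` span B) (range limit_operator) \<le> M * (\<Sum>b\<in>B. norm (\<phi> T (b - z b)))"
proof -
  have "infdist a (range limit_operator) \<le> M * (\<Sum>b\<in>B. norm (\<phi> T (b - z b)))"
    if a: "a \<in> \<phi> T ` span B" "norm a = 1" for a
  proof -
    obtain u where a_eq: "a = \<phi> T (\<Sum>b\<in>B. sc (u b) b)"
      using a(1) span_finite[OF finite_B] by auto
    have u: "(\<Sum>b\<in>B. norm (u b)) \<le> M"
      using M[OF T, of "\<Sum>b\<in>B. sc (u b) b"] a(2) by (simp add: coord_combination a_eq)
    have "(\<Sum>b\<in>B. sc (u b) (z b)) \<in> range limit_operator"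
      by (intro subspace_sum subspace_scale subspace_range_limit_operator z)
    then have "\<phi> T (\<Sum>b\<in>B. sc (u b) (z b)) \<in> range limit_operator"
      using invariant_range_limit_operator T unfolding invariant_def by blast
    then have "infdist a (range limit_operator) \<le> dist a (\<phi> T (\<Sum>b\<in>B. sc (u b) (z b)))"
      by (rule infdist_le)
    also have "\<dots> = norm (\<phi> T ((\<Sum>b\<in>B. sc (u b) b) - (\<Sum>b\<in>B. sc (u b) (z b))))"
      by (simp add: a_eq dist_norm linear_diff bounded_linear.linear semigroup_bounded_linear T)
    also have "(\<Sum>b\<in>B. sc (u b) b) - (\<Sum>b\<in>B. sc (u b) (z b)) = (\<Sum>b\<in>B. sc (u b) (b - z b))"
      by (simp add: sum_subtractf scale_right_diff_distrib)
    also have "norm (\<phi> T \<dots>) \<le> (\<Sum>b\<in>B. norm (u b) * norm (\<phi> T (b - z b)))"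
      unfolding semigroup_sum[OF T] semigroup_scale[OF T] by (rule sum_norm_le) (simp add: norm_scale)
    also have "\<dots> \<le> (\<Sum>b\<in>B. M * norm (\<phi> T (b - z b)))"
    proof (intro sum_mono mult_right_mono)
      fix b assume "b \<in> B"
      then have "norm (u b) \<le> (\<Sum>b\<in>B. norm (u b))" using finite_B by (intro member_le_sum) auto
      with u show "norm (u b) \<le> M" by simp
    qed simp
    finally show ?thesis by (simp add: sum_distrib_left)
  qed
  then show ?thesis
    unfolding deviation_def using \<open>M \<ge> 0\<close> by (intro cSup_least) (auto intro!: sum_nonneg mult_nonneg_nonneg)
qed

lemma deviation_nonneg:
  assumes "0 \<in> Z"
  shows "0 \<le> deviation S Z"
proof -
  have "infdist a Z \<le> 1" if "norm a = 1" for a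
    using infdist_le[OF assms, of a] that by simp
  then have "bdd_above (insert 0 ((\<lambda>a. infdist a Z) ` {a \<in> S. norm a = 1}))"
    by (intro bdd_aboveI[of _ 1]) auto
  then show ?thesis unfolding deviation_def by (intro cSup_upper) auto
qed

text \<open>
  The vectors \<open>z b\<close> are chosen congruent to \<open>b\<close> modulo the null space, so that \<open>\<phi> T (b - z b)\<close> tends
  to \<open>0\<close>. One of the two deviations thus vanishes in the limit, and the angle is their minimum.
\<close>

lemma angle_tendsto_0: "((\<lambda>T. subspace_angle (\<phi> T ` span B) (range limit_operator)) \<longlongrightarrow> 0) at_top"
proof -
  obtain M where M: "M > 0" "\<And>x t. t \<ge> 0 \<Longrightarrow> (\<Sum>b\<in>B. norm (coord x b)) \<le> M * norm (\<phi> t x)"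
    using coord_bounded_by_orbit by blast
  have "\<exists>z\<in>range limit_operator. b - z \<in> null_space \<phi>" for b
    using ex_limit_operator_congruent[of b] by blast
  then obtain z where z: "\<And>b. z b \<in> range limit_operator" "\<And>b. b - z b \<in> null_space \<phi>" by metis
  have "((\<lambda>T. \<Sum>b\<in>B. norm (\<phi> T (b - z b))) \<longlongrightarrow> (\<Sum>b\<in>B. 0)) at_top"
    using z(2) by (intro tendsto_sum tendsto_norm_zero) (simp add: null_space_def)
  then have lim: "((\<lambda>T. M * (\<Sum>b\<in>B. norm (\<phi> T (b - z b)))) \<longlongrightarrow> 0) at_top"
    by (auto intro: tendsto_mult_right_zero)
  have upper: "\<forall>\<^sub>F T in at_top. subspace_angle (\<phi> T ` span B) (range limit_operator) \<le> M * (\<Sum>b\<in>B. norm (\<phi> T (b - z b)))"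
    using eventually_ge_at_top[of "0::real"]
  proof eventually_elim
    case (elim T)
    then have "deviation (\<phi> T ` span B) (range limit_operator) \<le> M * (\<Sum>b\<in>B. norm (\<phi> T (b - z b)))"
      using M z(1) by (intro deviation_le) auto
    then show ?case by (simp add: subspace_angle_def)
  qed
  have lower: "\<forall>\<^sub>F T in at_top. 0 \<le> subspace_angle (\<phi> T ` span B) (range limit_operator)"
    using eventually_ge_at_top[of "0::real"]
  proof eventually_elim
    case (elim T)
    have "\<phi> T 0 \<in> \<phi> T ` span B" using span_zero by blast
    then have "0 \<in> \<phi> T ` span B"
      using elim by (simp add: linear_0 bounded_linear.linear semigroup_bounded_linear)
    then show ?case
      using subspace_0[OF subspace_range_limit_operator] by (simp add: subspace_angle_def deviation_nonneg)
  qed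
  show ?thesis by (rule tendsto_sandwich[OF lower upper tendsto_const lim])
qed

theorem span_B_stabilizable: "stabilizable sc \<phi> (span B)"
  unfolding stabilizable_def
  using subspace_range_limit_operator invariant_range_limit_operator direct_sum_range_limit_operator angle_tendsto_0 by blast

end

section \<open>Existence of weak limits\<close>

lemma (in normed_space_over) weak_topology_limit:
  assumes "limitin (weak_topology sc) h w G" and f: "f \<in> dual sc"
  shows "((\<lambda>t. f (h t)) \<longlongrightarrow> f w) G"
proof (rule topological_tendstoI)
  fix U assume U: "open U" "f w \<in> U"
  then have "openin (weak_topology sc) (f -` U)"
    unfolding weak_topology_def using f by (intro topology_generated_by_Basis) blast
  moreover have "w \<in> f -` U" using U(2) by simp
  ultimately have "eventually (\<lambda>t. h t \<in> f -` U) G" using assms(1) by (auto simp only: limitin_def)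
  then show "eventually (\<lambda>t. f (h t) \<in> U) G" by simp
qed

lemma (in normed_space_over) topspace_weak_topology: "topspace (weak_topology sc) = UNIV"
proof -
  have "(\<lambda>_. 0) \<in> dual sc" by (auto simp: dual_iff intro: exI[of _ 0])
  then have "(\<lambda>_. 0) -` UNIV \<in> {f -` U | f U. f \<in> dual sc \<and> open U}" by blast
  then show ?thesis
    unfolding weak_topology_def topology_generated_by_topspace by blast
qed

context normed_space_over
begin

text \<open>
  Relative weak compactness of a net: every finer filter has in turn a finer one along which \<open>h\<close>
  converges weakly. Quantifying over all finer filters allows several nets to be treated in turn.
\<close>

definition has_weak_limits :: "('t \<Rightarrow> 'a) \<Rightarrow> 't filter \<Rightarrow> bool" where
  "has_weak_limits h F \<longleftrightarrow> (\<forall>G\<le>F. G \<noteq> bot \<longrightarrow>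
     (\<exists>H w. H \<le> G \<and> H \<noteq> bot \<and> (\<forall>f\<in>dual sc. ((\<lambda>t. f (h t)) \<longlongrightarrow> f w) H)))"

lemma weakly_precompact_has_weak_limits:
  assumes S: "weakly_precompact sc S" and h: "\<forall>\<^sub>F t in F. h t \<in> S"
  shows "has_weak_limits h F"
  unfolding has_weak_limits_def
proof (intro allI impI)
  fix G assume G: "G \<le> F" "G \<noteq> bot"
  have "S \<subseteq> weak_topology sc closure_of S"
    by (rule closure_of_subset) (simp add: topspace_weak_topology)
  then have "\<forall>\<^sub>F t in G. h t \<in> weak_topology sc closure_of S"
    using filter_leD[OF G(1) h] by (auto elim: eventually_mono)
  then obtain w H where "H \<le> G" "H \<noteq> bot" "limitin (weak_topology sc) h w H"
    using compactin_imp_limit_along_finer_filter[of "weak_topology sc"] S G(2)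
    unfolding weakly_precompact_def by metis
  then show "\<exists>H w. H \<le> G \<and> H \<noteq> bot \<and> (\<forall>f\<in>dual sc. ((\<lambda>t. f (h t)) \<longlongrightarrow> f w) H)"
    using weak_topology_limit by blast
qed

text \<open>
  Bounded sets in a reflexive space are weakly precompact. By Tychonoff's theorem the values of all
  functionals converge simultaneously along a finer filter; the limit is a bounded linear functional
  on the dual, hence the evaluation at a vector, and this vector is the weak limit.
\<close>

lemma reflexive_has_weak_limits:
  assumes refl: "reflexive sc" and h: "\<forall>\<^sub>F t in F. norm (h t) \<le> R"
  shows "has_weak_limits h F"
  unfolding has_weak_limits_def
proof (intro allI impI)
  fix G assume G: "G \<le> F" "G \<noteq> bot"
  have dual_bl: "bounded_linear f" if "f \<in> dual sc" for f
    using that by (simp add: dual_def)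
  have functional_le: "norm (f x) \<le> R * onorm f" if f: "f \<in> dual sc" and x: "norm x \<le> R" for f x
  proof -
    have "norm (f x) \<le> onorm f * norm x" by (intro onorm dual_bl f)
    also have "\<dots> \<le> onorm f * R" using x onorm_pos_le[OF dual_bl[OF f]] by (rule mult_left_mono)
    finally show ?thesis by (simp add: mult.commute)
  qed
  \<comment> \<open>\<open>K\<close> and \<open>e\<close> are indexed by all functions, with coordinate \<open>0\<close> outside the dual.\<close>
  define K where "K = PiE UNIV (\<lambda>f. if f \<in> dual sc then cball (0::'k) (R * onorm f) else {0})"
  define e where "e t f = (if f \<in> dual sc then f (h t) else 0)" for t f
  have "compactin (product_topology (\<lambda>_. euclidean) UNIV) K"
    unfolding K_def by (subst compactin_PiE) auto
  moreover have "\<forall>\<^sub>F t in G. e t \<in> K"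
    using filter_leD[OF G(1) h]
  proof eventually_elim
    case (elim t)
    then show ?case using functional_le[of _ "h t"] by (auto simp: K_def e_def PiE_def)
  qed
  ultimately obtain \<Phi> H where H: "H \<le> G" "H \<noteq> bot"
      and lim: "limitin (product_topology (\<lambda>_. euclidean) UNIV) e \<Phi> H"
    using compactin_imp_limit_along_finer_filter[OF _ G(2)] by metis
  have lim: "((\<lambda>t. f (h t)) \<longlongrightarrow> \<Phi> f) H" if "f \<in> dual sc" for f
    using lim that by (auto simp: limitin_componentwise e_def dest: spec[of _ f])
  have unique: "\<Phi> f = l" if "f \<in> dual sc" "((\<lambda>t. f (h t)) \<longlongrightarrow> l) H" for f l
    using tendsto_unique[OF H(2) lim[OF that(1)] that(2)] .
  have add: "\<Phi> (\<lambda>x. f x + g x) = \<Phi> f + \<Phi> g" if fg: "f \<in> dual sc" "g \<in> dual sc" for f g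
  proof (rule unique)
    have "bounded_linear (\<lambda>x. f x + g x)" by (intro bounded_linear_add dual_bl fg)
    then have "\<exists>C. \<forall>x. norm (f x + g x) \<le> norm x * C" by (rule bounded_linear.bounded)
    then show "(\<lambda>x. f x + g x) \<in> dual sc"
      using fg by (simp add: dual_iff distrib_left add_ac)
    show "((\<lambda>t. f (h t) + g (h t)) \<longlongrightarrow> \<Phi> f + \<Phi> g) H"
      by (intro tendsto_add lim fg)
  qed
  have scale: "\<Phi> (\<lambda>x. c * f x) = c * \<Phi> f" if f: "f \<in> dual sc" for f c
  proof (rule unique)
    have "bounded_linear (\<lambda>x. c * f x)" by (intro bounded_linear_const_mult dual_bl f)
    then have "\<exists>C. \<forall>x. norm (c * f x) \<le> norm x * C" by (rule bounded_linear.bounded)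
    then show "(\<lambda>x. c * f x) \<in> dual sc"
      using f by (simp add: dual_iff distrib_left mult.left_commute)
    show "((\<lambda>t. c * f (h t)) \<longlongrightarrow> c * \<Phi> f) H"
      by (intro tendsto_mult_left lim f)
  qed
  have bound: "norm (\<Phi> f) \<le> R * onorm f" if "f \<in> dual sc" for f
  proof (rule tendsto_upperbound[OF tendsto_norm[OF lim[OF that]] _ H(2)])
    have "\<forall>\<^sub>F t in H. norm (h t) \<le> R" using H(1) G(1) h by (meson filter_leD order_trans)
    then show "\<forall>\<^sub>F t in H. norm (f (h t)) \<le> R * onorm f"
      by eventually_elim (rule functional_le[OF that])
  qed
  obtain w where "\<forall>f\<in>dual sc. \<Phi> f = f w"
    using refl[unfolded reflexive_def, rule_format, of \<Phi>] add scale bound by blast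
  with H lim show "\<exists>H w. H \<le> G \<and> H \<noteq> bot \<and> (\<forall>f\<in>dual sc. ((\<lambda>t. f (h t)) \<longlongrightarrow> f w) H)"
    by metis
qed

lemma common_weak_limits:
  assumes "finite B" and "\<And>b. b \<in> B \<Longrightarrow> has_weak_limits (\<lambda>t. h t b) F" and "F \<noteq> bot"
  shows "\<exists>G w. G \<le> F \<and> G \<noteq> bot \<and> (\<forall>b\<in>B. \<forall>f\<in>dual sc. ((\<lambda>t. f (h t b)) \<longlongrightarrow> f (w b)) G)"
  using assms(1,2)
proof (induction B)
  case empty
  then show ?case using assms(3) by auto
next
  case (insert b B)
  then obtain G w where G: "G \<le> F" "G \<noteq> bot"
      and w: "\<And>b f. b \<in> B \<Longrightarrow> f \<in> dual sc \<Longrightarrow> ((\<lambda>t. f (h t b)) \<longlongrightarrow> f (w b)) G"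
    by (metis insert_iff)
  obtain H v where H: "H \<le> G" "H \<noteq> bot"
      and v: "\<And>f. f \<in> dual sc \<Longrightarrow> ((\<lambda>t. f (h t b)) \<longlongrightarrow> f v) H"
    using insert.prems[of b] G unfolding has_weak_limits_def by blast
  have "((\<lambda>t. f (h t c)) \<longlongrightarrow> f ((w(b := v)) c)) H" if "c \<in> insert b B" "f \<in> dual sc" for c f
    using that v w[THEN tendsto_mono[OF H(1)]] by auto
  then show ?case using H G by (meson order_trans)
qed

end

section \<open>Stabilizability\<close>

lemma (in complemented_null_space) stabilizable_if_weak_limits:
  assumes "\<And>b. b \<in> B \<Longrightarrow> has_weak_limits (\<lambda>t. \<phi> t b) at_top"
  shows "stabilizable sc \<phi> (span B)"
proof -
  obtain G w where "G \<le> at_top" "G \<noteq> bot"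
      "\<forall>b\<in>B. \<forall>f\<in>dual sc. ((\<lambda>t. f (\<phi> t b)) \<longlongrightarrow> f (w b)) G"
    using common_weak_limits[OF finite_B, of \<phi> at_top] assms trivial_limit_at_top_linorder by blast
  then interpret weak_limit_of_basis sc \<phi> B G w
    by unfold_locales auto
  show ?thesis by (rule span_B_stabilizable)
qed

theorem theorem3:
  fixes sc :: "'k::{real_normed_field,euclidean_space} \<Rightarrow> 'a::banach \<Rightarrow> 'a"
    and \<phi> :: "real \<Rightarrow> 'a \<Rightarrow> 'a" and Y :: "'a set" and n :: nat
  assumes "normed_space_over sc"
    and "bounded_semigroup sc \<phi>"
    and "\<And>v. continuous_on {0<..} (\<lambda>t. \<phi> t v)"
    and "has_codim sc (null_space \<phi>) n"
    and "has_dim sc Y n"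
    and "is_direct_sum sc (null_space \<phi>) Y"
  shows "((\<forall>e\<in>Y. weakly_precompact sc ((\<lambda>t. \<phi> t e) ` {0..})) \<longrightarrow> stabilizable sc \<phi> Y) \<and>
         (reflexive sc \<longrightarrow> stabilizable sc \<phi> Y)"
proof -
  interpret normed_space_over sc by fact
  obtain B where B: "finite B" "independent B" "span B = Y"
    using assms(5) unfolding has_dim_def by blast
  interpret complemented_null_space sc \<phi> B
    by unfold_locales (use assms(2,6) B in auto)
  show ?thesis
  proof (intro conjI impI)
    assume *: "\<forall>e\<in>Y. weakly_precompact sc ((\<lambda>t. \<phi> t e) ` {0..})"
    have "has_weak_limits (\<lambda>t. \<phi> t b) at_top" if "b \<in> B" for b
    proof (rule weakly_precompact_has_weak_limits)
      show "weakly_precompact sc ((\<lambda>t. \<phi> t b) ` {0..})"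
        using * that B(3) span_base by blast
      show "\<forall>\<^sub>F t in at_top. \<phi> t b \<in> (\<lambda>t. \<phi> t b) ` {0..}"
        using eventually_ge_at_top[of "0::real"] by eventually_elim auto
    qed
    then show "stabilizable sc \<phi> Y"
      using stabilizable_if_weak_limits B(3) by simp
  next
    assume "reflexive sc"
    moreover obtain K where "K > 0" "\<And>t x. t \<ge> 0 \<Longrightarrow> norm (\<phi> t x) \<le> K * norm x"
      using semigroup_uniformly_bounded by blast
    then have "\<forall>\<^sub>F t in at_top. norm (\<phi> t b) \<le> K * norm b" for b
      by (auto simp: eventually_at_top_linorder)
    ultimately have "has_weak_limits (\<lambda>t. \<phi> t b) at_top" for b
      by (rule reflexive_has_weak_limits)
    then show "stabilizable sc \<phi> Y"
      using stabilizable_if_weak_limits B(3) by simp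
  qed
qed

end
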